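(* Let $n$ and $k$ be integers with $0\le k\le n$. If $X_1,\ldots,X_{k+1}\subset\mathbb R^n$ are $(n-k)$-convex compact sets and $0\in\operatorname{conv}X_i$ for every $i=1,\ldots,k+1$, then $0\in X_1*X_2*\cdots*X_{k+1}$.
   Context: A compact set $X\subset\mathbb R^n$ is called $m$-convex if for every linear map $A:\mathbb R^n\to\mathbb R^m$ the image $A(X)$ is convex (for $m=0$ this is automatic). For $A,B\subset\mathbb R^n$ the geometric join is $A*B=\{ta+(1-t)b: a\in A,\ b\in B,\ t\in[0,1]\}$; the iterated join $X_1*\cdots*X_{k+1}$ equals the set of all convex combinations $t_1x_1+\cdots+t_{k+1}x_{k+1}$ with $x_i\in X_i$, $t_i\ge0$, $\sum t_i=1$. *)

theory Defs
  imports "HOL-Analysis.Analysis"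
begin

text \<open>Every linear map A from R^n (= real^'n) to R^m is given by its m rows
  a 0, ..., a (m-1) in R^n; we represent vectors of R^m as functions
  nat => real vanishing outside {..<m}.\<close>
definition lin_map_to :: "nat \<Rightarrow> (nat \<Rightarrow> real^'n) \<Rightarrow> real^'n \<Rightarrow> (nat \<Rightarrow> real)" where
  "lin_map_to m a x = (\<lambda>i. if i < m then a i \<bullet> x else 0)"

definition convex_fun :: "(nat \<Rightarrow> real) set \<Rightarrow> bool" where
  "convex_fun S \<longleftrightarrow> (\<forall>u\<in>S. \<forall>v\<in>S. \<forall>t::real. 0 \<le> t \<and> t \<le> 1 \<longrightarrow>
      (\<lambda>i. t * u i + (1 - t) * v i) \<in> S)"

definition m_convex :: "nat \<Rightarrow> (real^'n) set \<Rightarrow> bool" where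
  "m_convex m X \<longleftrightarrow> compact X \<and>
     (\<forall>a :: nat \<Rightarrow> real^'n. convex_fun (lin_map_to m a ` X))"

definition join :: "nat \<Rightarrow> (nat \<Rightarrow> (real^'n) set) \<Rightarrow> (real^'n) set" where
  "join k X = {y. \<exists>t x. (\<forall>i\<le>k. 0 \<le> t i \<and> x i \<in> X i) \<and> (\<Sum>i\<le>k. t i) = 1 \<and>
                        y = (\<Sum>i\<le>k. t i *\<^sub>R x i)}"

end

theory Submission
  imports Defs
begin

text \<open>
  Suppose the point p of the join nearest to 0 is nonzero, and write p as a convex combination of
  points x i of X i. As in Barany's colourful Caratheodory theorem, no weight can vanish in any such
  representation, since otherwise the idle colour could be used to move closer to 0. Hence the x i
  are affinely independent and span p + D, where D has dimension k and is orthogonal to p. By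
  m-convexity, applied to a map with kernel D, every X i meets s p + D for all s < 1; letting s tend
  to 1 along a convergent subsequence yields points z i of X i in p + D. Mapping the boundary of
  the cross-polytope affinely on facets to p + D, with opposite vertices going to x i and z i, covers
  p by a second facet, for otherwise one could retract a simplex onto its boundary. Replacing
  the z i in that facet by nearby points of X i in s p + D gives a point of the join closer to 0.
\<close>

section \<open>Preliminaries on maxima and convex weights\<close>

lemma continuous_on_Max_image:
  fixes f :: "'i \<Rightarrow> 'a::topological_space \<Rightarrow> real"
  assumes "finite I" "I \<noteq> {}" "\<And>i. i \<in> I \<Longrightarrow> continuous_on S (f i)"
  shows "continuous_on S (\<lambda>y. Max ((\<lambda>i. f i y) ` I))"
  using assms
proof (induction I rule: finite_ne_induct)
  case (singleton i)
  then show ?case by simp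
next
  case (insert i I)
  have "continuous_on S (\<lambda>y. max (f i y) (Max ((\<lambda>i. f i y) ` I)))"
    by (rule continuous_on_max) (use insert in auto)
  with insert show ?case by (simp add: Max_insert)
qed

text \<open>Caratheodory's theorem for an indexed family: as \<open>v\<close> may repeat points,
  each point of the Caratheodory set is charged to one index in \<open>J\<close>. The bound on the
  support is what later turns positivity of all weights into affine independence.\<close>

lemma convex_hull_image_weights:
  fixes v :: "'i \<Rightarrow> 'a::euclidean_space"
  assumes "finite I" "y \<in> convex hull (v ` I)"
  obtains c where "\<And>i. 0 \<le> c i" "sum c I = 1" "(\<Sum>i\<in>I. c i *\<^sub>R v i) = y"
    "int (card {i \<in> I. c i \<noteq> 0}) \<le> aff_dim (v ` I) + 1"
proof -
  obtain S where S: "finite S" "S \<subseteq> v ` I" "int (card S) \<le> aff_dim (v ` I) + 1" "y \<in> convex hull S"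
    using assms(2) by (subst (asm) caratheodory_aff_dim) auto
  obtain J where J: "J \<subseteq> I" "inj_on v J" "S = v ` J"
    using S(2) by (auto simp: subset_image_inj)
  obtain u where u: "\<forall>x\<in>S. 0 \<le> u x" "sum u S = 1" "(\<Sum>x\<in>S. u x *\<^sub>R x) = y"
    using S(4) unfolding convex_hull_finite[OF S(1)] by auto
  define c where "c i = (if i \<in> J then u (v i) else 0)" for i
  have IJ: "I \<inter> J = J" using J by auto
  have "sum c I = (\<Sum>i\<in>J. u (v i))"
    unfolding c_def using assms(1) by (simp add: sum.If_cases IJ)
  then have "sum c I = 1"
    using u(2) J by (simp add: sum.reindex)
  moreover have "(\<Sum>i\<in>I. c i *\<^sub>R v i) = (\<Sum>i\<in>J. u (v i) *\<^sub>R v i)"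
    unfolding c_def using assms(1) by (simp add: if_distrib[of "\<lambda>a. a *\<^sub>R _"] sum.If_cases IJ)
  then have "(\<Sum>i\<in>I. c i *\<^sub>R v i) = y"
    using u(3) J by (simp add: sum.reindex)
  moreover have "card {i \<in> I. c i \<noteq> 0} \<le> card J"
    using assms(1) J by (intro card_mono) (auto simp: c_def finite_subset split: if_splits)
  then have "int (card {i \<in> I. c i \<noteq> 0}) \<le> aff_dim (v ` I) + 1"
    using S(3) J by (simp add: card_image)
  moreover have "0 \<le> c i" for i
    using u(1) J by (auto simp: c_def)
  ultimately show thesis using that by blast
qed

section \<open>A second facet of the cross-polytope covering a point\<close>

text \<open>A map from a sphere to an affine space of the same dimension has degree zero, so a point
  covered by the facet of the \<open>x i\<close> must be covered again; Brouwer's theorem stands in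
  for the degree. Since the \<open>x i\<close> are linearly independent, barycentric coordinates
  extend to linear functionals \<open>A j\<close>.\<close>

lemma octahedron_second_facet:
  fixes x z :: "'i \<Rightarrow> 'a::euclidean_space"
  assumes fin: "finite I"
    and inj: "inj_on x I" and ind: "independent (x ` I)"
    and z: "\<And>i. i \<in> I \<Longrightarrow> z i \<in> affine hull (x ` I)"
    and t: "\<And>i. i \<in> I \<Longrightarrow> 0 < t i" "sum t I = 1"
  obtains J c where "J \<subseteq> I" "J \<noteq> {}" "\<And>i. 0 \<le> c i" "sum c I = 1"
    "(\<Sum>i\<in>I. c i *\<^sub>R (if i \<in> J then z i else x i)) = (\<Sum>i\<in>I. t i *\<^sub>R x i)"
proof (rule ccontr)
  assume no: "\<not> thesis"
  note facet = that
  have ne: "I \<noteq> {}" using t(2) by auto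
  define p where "p = (\<Sum>i\<in>I. t i *\<^sub>R x i)"
  have "\<exists>f. linear f \<and> (\<forall>i\<in>I. f (x i) = (if i = j then 1 else 0::real))" if "j \<in> I" for j
  proof -
    obtain f where "linear f" "\<forall>v\<in>x ` I. f v = (if v = x j then 1 else 0::real)"
      using linear_independent_extend[OF ind, of "\<lambda>v. if v = x j then 1 else 0::real"] by auto
    then show ?thesis
      using inj that by (intro exI[of _ f]) (auto simp: inj_on_eq_iff)
  qed
  then obtain A where lin: "\<And>j. j \<in> I \<Longrightarrow> linear (A j)"
    and A: "\<And>i j. i \<in> I \<Longrightarrow> j \<in> I \<Longrightarrow> A j (x i) = (if i = j then 1 else 0::real)"
    by metis
  have contA: "continuous_on S (A j)" if "j \<in> I" for S j
    using lin[OF that] by (simp add: linear_continuous_on linear_conv_bounded_linear)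
  have A_comb: "A j (\<Sum>i\<in>I. w i *\<^sub>R x i) = w j" if "j \<in> I" for w j
  proof -
    have "A j (\<Sum>i\<in>I. w i *\<^sub>R x i) = (\<Sum>i\<in>I. w i * (if i = j then 1 else 0))"
      using that by (simp add: linear_sum[OF lin] linear_scale[OF lin] A)
    then show ?thesis using fin that by (simp add: sum.delta if_distrib cong: if_cong)
  qed
  \<comment> \<open>\<open>T\<close> reads off the total weight of a combination; the affine hull of
    the \<open>x i\<close> lies on its level 1.\<close>
  define T where "T v = (\<Sum>j\<in>I. A j v)" for v
  have linT: "linear T"
    unfolding T_def by (intro linear_compose_sum) (simp add: lin)
  have Tx: "T (x i) = 1" if "i \<in> I" for i
    using that fin by (simp add: T_def A)
  have T_aff: "T v = 1" if "v \<in> affine hull (x ` I)" for v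
  proof -
    have "affine {v. T v = 1}"
      unfolding affine_def by (auto simp: linear_add[OF linT] linear_scale[OF linT])
    with that show ?thesis
      using hull_minimal[of "x ` I" "{v. T v = 1}" affine] Tx by auto
  qed
  have expand: "v = (\<Sum>j\<in>I. A j v *\<^sub>R x j)" if "v \<in> span (x ` I)" for v
  proof -
    have "linear (\<lambda>v. \<Sum>j\<in>I. A j v *\<^sub>R x j)"
      by (intro linear_compose_sum ballI linearI)
         (simp_all add: linear_add[OF lin] linear_scale[OF lin] scaleR_left_distrib)
    moreover have "b = (\<Sum>j\<in>I. A j b *\<^sub>R x j)" if "b \<in> x ` I" for b
      using that fin by (auto simp: A if_distrib[of "\<lambda>a. a *\<^sub>R _"] cong: if_cong)
    ultimately show ?thesis
      using linear_eq_on_span[of "\<lambda>v. v" _ "x ` I" v] that by (auto simp: linear_id[unfolded id_def])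
  qed
  have zspan: "z i \<in> span (x ` I)" if "i \<in> I" for i
    using z[OF that] affine_hull_subset_span by blast
  \<comment> \<open>If no other facet covered p, then y \<mapsto> g y / G y would avoid p on the simplex \<open>\<sigma>\<close> while
    fixing its boundary (where the least barycentric coordinate m y is 0). Composing it with the
    projection from p to the antipodal boundary point gives a map \<open>\<phi>\<close> contradicting Brouwer.\<close>
  define m where "m y = - Max ((\<lambda>i. - A i y) ` I)" for y
  \<comment> \<open>Doubling \<open>m\<close> makes a least coordinate equal to
    \<open>- m y\<close>, hence nonpositive on the simplex, while on the boundary
    \<open>b y i\<close> is just \<open>A i y\<close>. Positive parts become weights of
    \<open>x i\<close>, negative parts weights of \<open>z i\<close>.\<close>
  define b where "b y i = A i y - 2 * m y" for y i
  \<comment> \<open>The inequality is weak so that \<open>J y\<close> is nonempty also on the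
    boundary, where its members have weight 0.\<close>
  define J where "J y = {i \<in> I. b y i \<le> 0}" for y
  define g where "g y = (\<Sum>i\<in>I. max (b y i) 0 *\<^sub>R x i + max (- b y i) 0 *\<^sub>R z i)" for y
  define G where "G y = (\<Sum>i\<in>I. \<bar>b y i\<bar>)" for y
  define q where "q y = g y - G y *\<^sub>R p" for y
  \<comment> \<open>On the ray from \<open>p\<close> in direction \<open>- q y\<close>, coordinate
    \<open>j\<close> at time \<open>a\<close> is \<open>t j - a * A j (q y)\<close>. The first
    coordinate to reach 0 does so at time \<open>1 / M y\<close>, so \<open>\<phi> y\<close> is the
    point where the ray leaves the simplex.\<close>
  define M where "M y = Max ((\<lambda>j. A j (q y) / t j) ` I)" for y
  define \<phi> where "\<phi> y = p - (1 / M y) *\<^sub>R q y" for y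
  define \<sigma> where "\<sigma> = convex hull (x ` I)"
  have m_le: "m y \<le> A i y" if "i \<in> I" for i y
  proof -
    have "- A i y \<le> Max ((\<lambda>i. - A i y) ` I)"
      using fin that by (intro Max_ge) auto
    then show ?thesis unfolding m_def by linarith
  qed
  have m_attained: "\<exists>i\<in>I. m y = A i y" for y
  proof -
    have "Max ((\<lambda>i. - A i y) ` I) \<in> (\<lambda>i. - A i y) ` I"
      using fin ne by (intro Max_in) auto
    then show ?thesis unfolding m_def by force
  qed
  have sig: "v \<in> span (x ` I)" "T v = 1" "\<And>j. j \<in> I \<Longrightarrow> 0 \<le> A j v" if "v \<in> \<sigma>" for v
  proof -
    have "v \<in> affine hull (x ` I)"
      using that convex_hull_subset_affine_hull unfolding \<sigma>_def by blast
    then show "v \<in> span (x ` I)" "T v = 1"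
      using affine_hull_subset_span T_aff by blast+
    fix j assume j: "j \<in> I"
    have "convex {v. 0 \<le> A j v}"
      unfolding convex_def by (auto simp: linear_add[OF lin] linear_scale[OF lin] j)
    moreover have "x ` I \<subseteq> {v. 0 \<le> A j v}" using A j by auto
    ultimately show "0 \<le> A j v"
      using that hull_minimal[of "x ` I" "{v. 0 \<le> A j v}" convex] unfolding \<sigma>_def by blast
  qed
  have m_nonneg: "0 \<le> m y" if "y \<in> \<sigma>" for y
    using m_attained[of y] sig(3)[OF that] by auto
  have Jne: "J y \<noteq> {}" if "y \<in> \<sigma>" for y
    using m_attained[of y] m_nonneg[OF that] by (auto simp: J_def b_def)
  have Gpos: "0 < G y" if y: "y \<in> \<sigma>" for y
  proof (rule ccontr)
    assume "\<not> 0 < G y"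
    moreover have "0 \<le> G y" unfolding G_def by (simp add: sum_nonneg)
    ultimately have "G y = 0" by simp
    then have "\<forall>i\<in>I. b y i = 0"
      using fin unfolding G_def by (simp add: sum_nonneg_eq_0_iff)
    then have *: "\<forall>i\<in>I. A i y = 2 * m y" by (simp add: b_def)
    then have "m y = 0" using m_attained[of y] by auto
    with * have "T y = 0" by (simp add: T_def)
    then show False using sig(2)[OF y] by simp
  qed
  have g_eq: "g y = (\<Sum>i\<in>I. \<bar>b y i\<bar> *\<^sub>R (if i \<in> J y then z i else x i))" for y
    unfolding g_def by (intro sum.cong) (auto simp: J_def)
  have qne: "q y \<noteq> 0" if y: "y \<in> \<sigma>" for y
  proof
    assume "q y = 0"
    then have *: "g y = G y *\<^sub>R p" by (simp add: q_def)
    have "(\<Sum>i\<in>I. (\<bar>b y i\<bar> / G y) *\<^sub>R (if i \<in> J y then z i else x i)) = (1 / G y) *\<^sub>R g y"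
      unfolding g_eq scaleR_sum_right by simp
    also have "\<dots> = p" using * Gpos[OF y] by simp
    finally have 1: "(\<Sum>i\<in>I. (\<bar>b y i\<bar> / G y) *\<^sub>R (if i \<in> J y then z i else x i)) = p" .
    have 2: "(\<Sum>i\<in>I. \<bar>b y i\<bar> / G y) = 1"
      using Gpos[OF y] by (simp add: G_def flip: sum_divide_distrib)
    show False
      using no facet[of "J y" "\<lambda>i. \<bar>b y i\<bar> / G y"] 1 2 Jne[OF y] Gpos[OF y]
      by (auto simp: J_def p_def)
  qed
  have Tp: "T p = 1"
    unfolding p_def by (simp add: T_def A_comb t)
  have pspan: "p \<in> span (x ` I)"
    unfolding p_def by (intro span_sum span_scale span_base) auto
  have Tg: "T (g y) = G y" for y
  proof -
    have "T (g y) = (\<Sum>i\<in>I. max (b y i) 0 + max (- b y i) 0)"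
      unfolding g_def linear_sum[OF linT] using z
      by (intro sum.cong) (auto simp: linear_add[OF linT] linear_scale[OF linT] Tx T_aff)
    also have "\<dots> = G y" unfolding G_def by (intro sum.cong) auto
    finally show ?thesis .
  qed
  have Tq: "T (q y) = 0" for y
    by (simp add: q_def linear_diff[OF linT] linear_scale[OF linT] Tg Tp)
  have qspan: "q y \<in> span (x ` I)" for y
    unfolding q_def g_def
    by (intro span_diff span_scale pspan span_sum span_add zspan span_base) auto
  have Mge: "A j (q y) / t j \<le> M y" if "j \<in> I" for j y
    unfolding M_def using fin that by (intro Max_ge) auto
  \<comment> \<open>The coordinates of \<open>q y\<close> sum to 0, so unless all vanish one of them
    is positive.\<close>
  have Mpos: "0 < M y" if y: "y \<in> \<sigma>" for y
  proof (rule ccontr)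
    assume "\<not> 0 < M y"
    then have "A j (q y) \<le> 0" if "j \<in> I" for j
      using Mge[OF that, of y] t(1)[OF that] by (smt (verit) divide_pos_pos)
    moreover have "(\<Sum>j\<in>I. - A j (q y)) = 0"
      using Tq[of y] by (simp add: T_def sum_negf)
    ultimately have "\<forall>j\<in>I. A j (q y) = 0"
      using fin by (subst (asm) sum_nonneg_eq_0_iff) auto
    then have "q y = 0" using expand[OF qspan, of y] by simp
    then show False using qne[OF y] by simp
  qed
  have A\<phi>: "A j (\<phi> y) = t j - A j (q y) / M y" if "j \<in> I" for j y
    using that by (simp add: \<phi>_def linear_diff[OF lin] linear_scale[OF lin] p_def A_comb)
  have \<phi>_in: "\<phi> y \<in> \<sigma>" if y: "y \<in> \<sigma>" for y
  proof -
    have "\<phi> y \<in> span (x ` I)"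
      unfolding \<phi>_def by (intro span_diff span_scale pspan qspan)
    then have e: "\<phi> y = (\<Sum>j\<in>I. A j (\<phi> y) *\<^sub>R x j)" by (rule expand)
    have "T (\<phi> y) = 1"
      by (simp add: \<phi>_def linear_diff[OF linT] linear_scale[OF linT] Tp Tq)
    moreover have "0 \<le> A j (\<phi> y)" if "j \<in> I" for j
      using Mge[OF that, of y] Mpos[OF y] t(1)[OF that]
      by (simp add: A\<phi> that field_simps)
    ultimately show ?thesis
      unfolding \<sigma>_def using fin
      by (subst e) (intro convex_sum convex_convex_hull hull_inc, auto simp: T_def)
  qed
  have contb: "continuous_on \<sigma> (\<lambda>y. b y i)" if "i \<in> I" for i
    unfolding b_def m_def
    by (intro continuous_intros continuous_on_Max_image contA fin ne that)
  have contq: "continuous_on \<sigma> q"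
    unfolding q_def g_def G_def by (intro continuous_intros contb)
  have contM: "continuous_on \<sigma> M"
    unfolding M_def using t(1)
    by (intro continuous_on_Max_image fin ne continuous_intros
        continuous_on_compose2[OF contA[of _ UNIV] contq]) force+
  have "continuous_on \<sigma> \<phi>"
    unfolding \<phi>_def using Mpos by (intro continuous_intros contM contq) force
  moreover have "compact \<sigma>" "convex \<sigma>" "\<sigma> \<noteq> {}"
    using fin ne by (auto simp: \<sigma>_def finite_imp_compact_convex_hull)
  ultimately obtain y where y: "y \<in> \<sigma>" "\<phi> y = y"
    using brouwer[of \<sigma> \<phi>] \<phi>_in by auto
  \<comment> \<open>The coordinate attaining the maximum vanishes at the exit point, which is
    \<open>y\<close> itself. So \<open>y\<close> lies on the boundary, where \<open>g\<close> is the
    identity and \<open>G\<close> is 1.\<close>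
  obtain j where j: "j \<in> I" "M y = A j (q y) / t j"
  proof -
    have "M y \<in> (\<lambda>j. A j (q y) / t j) ` I"
      unfolding M_def using fin ne by (intro Max_in) auto
    then show thesis using that by blast
  qed
  have "A j (q y) = M y * t j"
    using j(2) t(1)[OF j(1)] by simp
  then have "A j y = 0"
    using A\<phi>[OF j(1), of y] y(2) Mpos[OF y(1)] by simp
  then have "m y = 0"
    using m_le[OF j(1), of y] m_nonneg[OF y(1)] by simp
  then have b: "b y i = A i y" for i by (simp add: b_def)
  have "g y = (\<Sum>j\<in>I. A j y *\<^sub>R x j)"
    unfolding g_def b using sig(3)[OF y(1)] by (intro sum.cong) auto
  then have "g y = y" using expand[OF sig(1)[OF y(1)]] by simp
  moreover have "G y = 1"
    using sig(2,3)[OF y(1)] by (simp add: G_def b T_def)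
  ultimately have "q y = y - p" by (simp add: q_def)
  \<comment> \<open>The fixed point lies on the opposite side of \<open>p\<close> from itself:
    \<open>y - p\<close> is a negative multiple of \<open>y - p\<close>.\<close>
  then have "q y + (1 / M y) *\<^sub>R q y = 0"
    using y(2) unfolding \<phi>_def by (simp add: algebra_simps)
  then have "(1 + 1 / M y) *\<^sub>R q y = 0" by (simp add: scaleR_left_distrib)
  moreover have "1 + 1 / M y > 0" using Mpos[OF y(1)] by (simp add: add_pos_pos)
  ultimately show False using qne[OF y(1)] by simp
qed

section \<open>The iterated join and its compactness\<close>

lemma joinI:
  assumes "\<And>i. i \<le> k \<Longrightarrow> x i \<in> X i" "\<And>i. i \<le> k \<Longrightarrow> 0 \<le> t i" "sum t {..k} = 1"
    "(\<Sum>i\<le>k. t i *\<^sub>R x i) = y"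
  shows "y \<in> join k X"
  using assms unfolding join_def by blast

text \<open>Splitting off the last set makes compactness an induction over joins of two sets.
  Nonemptiness supplies a point \<open>a\<close> when the last weight is 1 and the others cannot be
  normalised.\<close>

lemma join_Suc:
  assumes "join k X \<noteq> {}"
  shows "join (Suc k) X =
    {(1 - u) *\<^sub>R a + u *\<^sub>R b | a b u. 0 \<le> u \<and> u \<le> 1 \<and> a \<in> join k X \<and> b \<in> X (Suc k)}"
    (is "?L = ?R")
proof (intro subset_antisym subsetI)
  fix y assume "y \<in> ?L"
  then obtain t x where tx: "\<And>i. i \<le> Suc k \<Longrightarrow> 0 \<le> t i" "\<And>i. i \<le> Suc k \<Longrightarrow> x i \<in> X i"
    "(\<Sum>i\<le>Suc k. t i) = 1" "y = (\<Sum>i\<le>Suc k. t i *\<^sub>R x i)"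
    unfolding join_def by blast
  define u where "u = t (Suc k)"
  have s: "sum t {..k} = 1 - u" using tx(3) by (simp add: u_def)
  have u: "0 \<le> u" "u \<le> 1"
    using tx(1) s sum_nonneg[of "{..k}" t] by (auto simp: u_def)
  have "\<exists>a\<in>join k X. (\<Sum>i\<le>k. t i *\<^sub>R x i) = (1 - u) *\<^sub>R a"
  proof (cases "u = 1")
    case True
    then have "\<forall>i\<in>{..k}. t i = 0"
      using s tx(1) by (subst sum_nonneg_eq_0_iff[symmetric]) auto
    with True assms show ?thesis by auto
  next
    case False
    have "(\<Sum>i\<le>k. (t i / (1 - u)) *\<^sub>R x i) \<in> join k X"
      using tx(1,2) u s False
      by (intro joinI[where t="\<lambda>i. t i / (1 - u)"]) (auto simp flip: sum_divide_distrib)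
    moreover have "(\<Sum>i\<le>k. t i *\<^sub>R x i) = (1 - u) *\<^sub>R (\<Sum>i\<le>k. (t i / (1 - u)) *\<^sub>R x i)"
      using False by (simp add: scaleR_sum_right)
    ultimately show ?thesis by blast
  qed
  then obtain a where "a \<in> join k X" "(\<Sum>i\<le>k. t i *\<^sub>R x i) = (1 - u) *\<^sub>R a" by blast
  moreover from this have "y = (1 - u) *\<^sub>R a + u *\<^sub>R x (Suc k)"
    using tx(4) by (simp add: u_def)
  ultimately show "y \<in> ?R"
    using tx(2)[of "Suc k"] u by blast
next
  fix y assume "y \<in> ?R"
  then obtain a b u where u: "0 \<le> u" "u \<le> 1" and a: "a \<in> join k X" and b: "b \<in> X (Suc k)"
    and y: "y = (1 - u) *\<^sub>R a + u *\<^sub>R b" by blast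
  obtain t x where tx: "\<And>i. i \<le> k \<Longrightarrow> 0 \<le> t i" "\<And>i. i \<le> k \<Longrightarrow> x i \<in> X i"
    "(\<Sum>i\<le>k. t i) = 1" "a = (\<Sum>i\<le>k. t i *\<^sub>R x i)"
    using a unfolding join_def by blast
  show "y \<in> ?L"
  proof (rule joinI)
    let ?t = "\<lambda>i. if i \<le> k then (1 - u) * t i else u"
    let ?x = "\<lambda>i. if i \<le> k then x i else b"
    show "?x i \<in> X i" if "i \<le> Suc k" for i
      using that tx(2) b by (auto simp: le_Suc_eq)
    show "0 \<le> ?t i" if "i \<le> Suc k" for i
      using u tx(1) by auto
    show "sum ?t {..Suc k} = 1"
      using tx(3) by (simp flip: sum_distrib_left)
    show "(\<Sum>i\<le>Suc k. ?t i *\<^sub>R ?x i) = y"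
      using tx(4) y by (simp add: scaleR_sum_right)
  qed
qed

lemma join_nonempty:
  assumes "\<And>i. i \<le> k \<Longrightarrow> X i \<noteq> {}"
  shows "join k X \<noteq> {}"
proof -
  obtain x where "\<And>i. i \<le> k \<Longrightarrow> x i \<in> X i"
    using assms by (meson equals0I)
  then have "(\<Sum>i\<le>k. (if i = 0 then 1 else 0) *\<^sub>R x i) \<in> join k X"
    by (intro joinI[where t="\<lambda>i. if i = 0 then 1 else 0"]) auto
  then show ?thesis by blast
qed

lemma compact_join:
  assumes "\<And>i. i \<le> k \<Longrightarrow> compact (X i)" "\<And>i. i \<le> k \<Longrightarrow> X i \<noteq> {}"
  shows "compact (join k X)"
  using assms
proof (induction k)
  case 0
  have "join 0 X = X 0"
    unfolding join_def by (auto intro!: exI[of _ "\<lambda>_. 1::real"] exI[of _ "\<lambda>_. _"])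
  then show ?case using 0 by simp
next
  case (Suc k)
  have eq: "join (Suc k) X =
    {(1 - u) *\<^sub>R a + u *\<^sub>R b | a b u. 0 \<le> u \<and> u \<le> 1 \<and> a \<in> join k X \<and> b \<in> X (Suc k)}"
    using Suc.prems(2) by (intro join_Suc join_nonempty) simp
  show ?case
    unfolding eq using Suc by (intro compact_convex_combinations) auto
qed

section \<open>Sections of m-convex sets\<close>

text \<open>Project along \<open>D\<close>: the points sharing their image with a point of
  \<open>X\<close> form a convex set containing \<open>X\<close>, hence containing
  \<open>y\<close>.\<close>

lemma m_convex_meets:
  fixes X :: "(real^'n) set"
  assumes X: "m_convex m X" and D: "subspace D" "dim D + m = CARD('n)"
    and y: "y \<in> convex hull X"
  obtains x where "x \<in> X" "x - y \<in> D"
proof -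
  define W where "W = {w. \<forall>d\<in>D. orthogonal d w}"
  have "dim W + dim D = CARD('n)"
    using dim_subspace_orthogonal_to_vectors[OF D(1) subspace_UNIV] by (simp add: W_def)
  then have "dim W = m" using D(2) by simp
  then obtain B where B: "W \<subseteq> span B" "finite B" "card B = m"
    using basis_exists[of W] by (metis finiteI_independent)
  obtain h where h: "bij_betw h {0..<m} B"
    using ex_bij_betw_nat_finite[OF B(2)] B(3) by auto
  \<comment> \<open>The rows are a basis of the orthogonal complement \<open>W\<close> of
    \<open>D\<close>, so the kernel lies in \<open>D\<close>.\<close>
  let ?L = "lin_map_to m h"
  have "convex {x. ?L x \<in> ?L ` X}"
  proof (rule convexI, clarify)
    fix x1 x2 z1 z2 and u v :: real
    assume uv: "0 \<le> u" "0 \<le> v" "u + v = 1"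
      and z: "z1 \<in> X" "?L x1 = ?L z1" "z2 \<in> X" "?L x2 = ?L z2"
    have "(\<lambda>i. u * ?L z1 i + (1 - u) * ?L z2 i) \<in> ?L ` X"
      using X z uv unfolding m_convex_def convex_fun_def by auto
    moreover have "?L (u *\<^sub>R x1 + v *\<^sub>R x2) = (\<lambda>i. u * ?L x1 i + (1 - u) * ?L x2 i)"
      using uv by (auto simp: lin_map_to_def inner_add_right)
    ultimately show "?L (u *\<^sub>R x1 + v *\<^sub>R x2) \<in> ?L ` X"
      using z by simp
  qed
  then have "convex hull X \<subseteq> {x. ?L x \<in> ?L ` X}"
    by (intro hull_minimal) auto
  then obtain x where x: "x \<in> X" "?L y = ?L x" using y by blast
  have "(x - y) \<bullet> b = 0" if "b \<in> B" for b
  proof -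
    obtain i where i: "i < m" "b = h i"
      using h \<open>b \<in> B\<close> unfolding bij_betw_def by (metis atLeastLessThan_iff imageE)
    then show ?thesis
      using fun_cong[OF x(2), of i] by (simp add: lin_map_to_def inner_diff_right inner_commute)
  qed
  then have orth: "orthogonal (x - y) w" if "w \<in> W" for w
    using B(1) that orthogonal_to_span[of w B "x - y"] by (auto simp: orthogonal_def)
  obtain d w where dw: "d \<in> D" "\<And>v. v \<in> D \<Longrightarrow> orthogonal w v" "x - y = d + w"
    using orthogonal_subspace_decomp_exists[of D "x - y"] D(1) by (metis span_eq_iff)
  have "w \<in> W" using dw(2) by (simp add: W_def orthogonal_commute)
  then have "w \<bullet> w = 0"
    using orth[of w] dw by (auto simp: orthogonal_def inner_add_right inner_commute)
  then have "x - y \<in> D" using dw by simp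
  with x(1) show thesis using that by blast
qed

section \<open>Representations of the nearest point of the join\<close>

text \<open>If \<open>c j\<close> vanishes, \<open>v j\<close> may be exchanged freely. As 0 lies in
  the hull of \<open>X j\<close>, some \<open>u\<close> in \<open>X j\<close> has
  \<open>p \<bullet> u \<le> 0\<close>, and a short move from \<open>p\<close> towards
  \<open>u\<close> stays in the join and decreases the norm.\<close>

lemma nearest_weights_pos:
  assumes hull: "\<And>i. i \<le> k \<Longrightarrow> 0 \<in> convex hull (X i)"
    and nearest: "\<And>q. q \<in> join k X \<Longrightarrow> norm p \<le> norm q" and "p \<noteq> 0"
    and v: "\<And>i. i \<le> k \<Longrightarrow> v i \<in> X i"
    and c: "\<And>i. i \<le> k \<Longrightarrow> 0 \<le> c i" "sum c {..k} = 1" "(\<Sum>i\<le>k. c i *\<^sub>R v i) = p"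
    and j: "j \<le> k"
  shows "0 < c j"
proof (rule ccontr)
  assume "\<not> 0 < c j"
  then have cj: "c j = 0" using c(1)[OF j] by simp
  have "\<exists>u\<in>X j. p \<bullet> u \<le> 0"
  proof (rule ccontr)
    assume "\<not> (\<exists>u\<in>X j. p \<bullet> u \<le> 0)"
    then have "convex hull (X j) \<subseteq> {u. p \<bullet> u > 0}"
      by (intro hull_minimal) (auto simp: convex_halfspace_gt)
    then show False using hull[OF j] by auto
  qed
  then obtain u where u: "u \<in> X j" "p \<bullet> u \<le> 0" by blast
  have "p \<bullet> p > 0" using \<open>p \<noteq> 0\<close> by simp
  then have "(0 - p) \<bullet> (u - p) > 0"
    using u(2) by (simp only: inner_diff_right diff_0 inner_minus_left)
  then obtain e where e: "e > 0" "e \<le> 1" "dist (p + e *\<^sub>R (u - p)) 0 < dist p 0"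
    using closer_point_lemma by blast
  have rest: "sum f {..k} = f j + sum f ({..k} - {j})" for f :: "nat \<Rightarrow> 'b::comm_monoid_add"
    using j by (intro sum.remove) auto
  have "p + e *\<^sub>R (u - p) \<in> join k X"
  proof (rule joinI)
    let ?t = "\<lambda>i. if i = j then e else (1 - e) * c i"
    let ?x = "\<lambda>i. if i = j then u else v i"
    show "?x i \<in> X i" if "i \<le> k" for i using that v u by auto
    show "0 \<le> ?t i" if "i \<le> k" for i using that c e by auto
    have "sum ?t ({..k} - {j}) = (1 - e) * sum c ({..k} - {j})"
      by (simp add: sum_distrib_left)
    then show "sum ?t {..k} = 1"
      using c(2) cj by (simp add: rest)
    have "(\<Sum>i\<in>{..k} - {j}. ?t i *\<^sub>R ?x i) = (1 - e) *\<^sub>R (\<Sum>i\<in>{..k} - {j}. c i *\<^sub>R v i)"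
      by (simp add: scaleR_sum_right)
    moreover have "(\<Sum>i\<in>{..k} - {j}. c i *\<^sub>R v i) = p"
      using c(3) cj by (simp add: rest)
    ultimately show "(\<Sum>i\<le>k. ?t i *\<^sub>R ?x i) = p + e *\<^sub>R (u - p)"
      by (simp add: rest algebra_simps)
  qed
  then show False using nearest e(3) by force
qed

text \<open>Were the \<open>v i\<close> affinely dependent, Caratheodory would represent
  \<open>p\<close> with some weight zero, against \<open>nearest_weights_pos\<close>.\<close>

lemma nearest_aff_dim:
  fixes X :: "nat \<Rightarrow> (real^'n) set"
  assumes hull: "\<And>i. i \<le> k \<Longrightarrow> 0 \<in> convex hull (X i)"
    and nearest: "\<And>q. q \<in> join k X \<Longrightarrow> norm p \<le> norm q" and "p \<noteq> 0"
    and v: "\<And>i. i \<le> k \<Longrightarrow> v i \<in> X i"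
    and c: "\<And>i. i \<le> k \<Longrightarrow> 0 \<le> c i" "sum c {..k} = 1" "(\<Sum>i\<le>k. c i *\<^sub>R v i) = p"
  shows "aff_dim (v ` {..k}) = int k"
proof -
  have "p \<in> convex hull (v ` {..k})"
    using c(1,2) unfolding c(3)[symmetric] by (intro convex_sum convex_convex_hull hull_inc) auto
  then obtain d where d: "\<And>i. 0 \<le> d i" "sum d {..k} = 1" "(\<Sum>i\<le>k. d i *\<^sub>R v i) = p"
    "int (card {i \<in> {..k}. d i \<noteq> 0}) \<le> aff_dim (v ` {..k}) + 1"
    using convex_hull_image_weights[of "{..k}" p v] by auto
  have "0 < d j" if "j \<le> k" for j
    by (rule nearest_weights_pos[of k X p v d, OF hull nearest \<open>p \<noteq> 0\<close> v]) (use d that in auto)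
  then have "{i \<in> {..k}. d i \<noteq> 0} = {..k}" by force
  then have "int k \<le> aff_dim (v ` {..k})" using d(4) by simp
  moreover have "aff_dim (v ` {..k}) \<le> int (card (v ` {..k})) - 1"
    by (rule aff_dim_le_card) simp
  moreover have "card (v ` {..k}) \<le> Suc k"
    using card_image_le[of "{..k}" v] by simp
  ultimately show ?thesis by linarith
qed

section \<open>Stability of a positive relation under perturbation\<close>

text \<open>Otherwise each hull is separated from 0 by a unit vector in the span of the
  \<open>w0 i\<close>. A limit \<open>u\<close> of these has nonnegative products with all
  \<open>w0 i\<close>; the positive relation makes them zero, so \<open>u\<close> is orthogonal to a
  span containing it. This is why the \<open>w n i\<close> must stay in that span.\<close>

lemma zero_in_hull_perturbation:
  fixes w :: "nat \<Rightarrow> 'i \<Rightarrow> 'a::euclidean_space"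
  assumes I: "finite I" "I \<noteq> {}"
    and w: "\<And>n i. i \<in> I \<Longrightarrow> w n i \<in> span (w0 ` I)"
    and lim: "\<And>i. i \<in> I \<Longrightarrow> (\<lambda>n. w n i) \<longlonglongrightarrow> w0 i"
    and c: "\<And>i. i \<in> I \<Longrightarrow> 0 < c i" "(\<Sum>i\<in>I. c i *\<^sub>R w0 i) = 0"
  obtains n where "0 \<in> convex hull (w n ` I)"
proof (rule ccontr)
  assume "\<not> thesis"
  then have no: "0 \<notin> convex hull (w n ` I)" for n using that by blast
  let ?D = "span (w0 ` I)"
  \<comment> \<open>The separating vector is the normalised point of the hull nearest to 0.\<close>
  have "\<exists>u\<in>?D. norm u = 1 \<and> (\<forall>i\<in>I. 0 \<le> u \<bullet> w n i)" for n
  proof -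
    let ?H = "convex hull (w n ` I)"
    have H: "closed ?H" "?H \<noteq> {}" "convex ?H"
      using I by (auto simp: compact_imp_closed finite_imp_compact_convex_hull)
    obtain q where q: "q \<in> ?H" "\<And>y. y \<in> ?H \<Longrightarrow> dist 0 q \<le> dist 0 y"
      using distance_attains_inf[OF H(1,2), of 0] by blast
    have "q \<noteq> 0" using q(1) no by auto
    have "?H \<subseteq> ?D" using w by (intro hull_minimal) (auto simp: subspace_imp_convex)
    then have "q \<in> ?D" using q(1) by blast
    have "0 \<le> q \<bullet> w n i" if "i \<in> I" for i
    proof -
      have "w n i \<in> ?H" using that by (simp add: hull_inc)
      then have "(0 - q) \<bullet> (w n i - q) \<le> 0"
        using any_closest_point_dot[OF H(3,1) q(1)] q(2) by blast
      then have "q \<bullet> q \<le> q \<bullet> w n i" by (simp add: inner_diff_right)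
      then show ?thesis using inner_ge_zero[of q] by linarith
    qed
    then show ?thesis
      using \<open>q \<noteq> 0\<close> \<open>q \<in> ?D\<close>
      by (intro bexI[of _ "(1 / norm q) *\<^sub>R q"]) (auto intro: span_scale)
  qed
  then obtain U where U: "\<And>n. U n \<in> ?D" "\<And>n. norm (U n) = 1"
    "\<And>n i. i \<in> I \<Longrightarrow> 0 \<le> U n \<bullet> w n i"
    by metis
  have "compact (sphere 0 1 \<inter> ?D)"
    by (intro compact_Int_closed compact_sphere closed_subspace subspace_span)
  then obtain u \<rho> where u: "u \<in> sphere 0 1 \<inter> ?D" "strict_mono \<rho>" "(U \<circ> \<rho>) \<longlonglongrightarrow> u"
    using U(1,2) unfolding compact_def by (metis IntI mem_sphere_0)
  have "0 \<le> u \<bullet> w0 i" if "i \<in> I" for i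
  proof -
    have "(\<lambda>n. U (\<rho> n) \<bullet> w (\<rho> n) i) \<longlonglongrightarrow> u \<bullet> w0 i"
      using u(3) LIMSEQ_subseq_LIMSEQ[OF lim[OF that] u(2)]
      by (intro tendsto_inner) (auto simp: o_def)
    then show ?thesis
      using U(3)[OF that] by (intro LIMSEQ_le_const) auto
  qed
  moreover have "(\<Sum>i\<in>I. c i * (u \<bullet> w0 i)) = u \<bullet> (\<Sum>i\<in>I. c i *\<^sub>R w0 i)"
    by (simp add: inner_sum_right)
  then have "(\<Sum>i\<in>I. c i * (u \<bullet> w0 i)) = 0" using c(2) by simp
  ultimately have "\<forall>i\<in>I. c i * (u \<bullet> w0 i) = 0"
    using I c(1) by (subst (asm) sum_nonneg_eq_0_iff) (auto simp: less_imp_le)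
  then have "\<forall>i\<in>I. u \<bullet> w0 i = 0" using c(1) by force
  then have "orthogonal u u"
    using u(1) by (intro orthogonal_to_span[of u "w0 ` I"]) (auto simp: orthogonal_def)
  then show False using u(1) by (auto simp: orthogonal_def)
qed

section \<open>The nearest point of the join is 0\<close>

theorem theorem4p3:
  fixes k :: nat and X :: "nat \<Rightarrow> (real^'n) set"
  assumes "k \<le> CARD('n)"
    and "\<And>i. i \<le> k \<Longrightarrow> compact (X i)"
    and "\<And>i. i \<le> k \<Longrightarrow> m_convex (CARD('n) - k) (X i)"
    and "\<And>i. i \<le> k \<Longrightarrow> 0 \<in> convex hull (X i)"
  shows "0 \<in> join k X"
proof -
  note hull = assms(4)
  have ne: "X i \<noteq> {}" if "i \<le> k" for i
    using hull[OF that] by auto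
  obtain p where p: "p \<in> join k X" and near: "\<And>q. q \<in> join k X \<Longrightarrow> norm p \<le> norm q"
    using distance_attains_inf[of "join k X" 0] compact_join[of k X] join_nonempty[of k X] assms(2) ne
    by (auto simp: compact_imp_closed)
  have "p = 0"
  proof (rule ccontr)
    assume p0: "p \<noteq> 0"
    have pos: "0 < c j"
      if "\<And>i. i \<le> k \<Longrightarrow> v i \<in> X i" "\<And>i. i \<le> k \<Longrightarrow> 0 \<le> c i" "sum c {..k} = 1"
        "(\<Sum>i\<le>k. c i *\<^sub>R v i) = p" "j \<le> k" for v c j
      by (rule nearest_weights_pos[of k X p v c j]) (use hull near p0 that in auto)
    have dim_k: "aff_dim (v ` {..k}) = int k"
      if "\<And>i. i \<le> k \<Longrightarrow> v i \<in> X i" "\<And>i. i \<le> k \<Longrightarrow> 0 \<le> c i" "sum c {..k} = 1"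
        "(\<Sum>i\<le>k. c i *\<^sub>R v i) = p" for v c
      by (rule nearest_aff_dim[of k X p v c]) (use hull near p0 that in auto)
    obtain t x where t: "\<And>i. i \<le> k \<Longrightarrow> 0 \<le> t i" "sum t {..k} = 1" "(\<Sum>i\<le>k. t i *\<^sub>R x i) = p"
      and x: "\<And>i. i \<le> k \<Longrightarrow> x i \<in> X i"
      using p unfolding join_def by blast
    have tpos: "0 < t i" if "i \<le> k" for i
      using pos[of x t i] x t that by blast
    have aff: "aff_dim (x ` {..k}) = int k"
      using dim_k[of x t] x t by blast
    have p_hull: "p \<in> convex hull (x ` {..k})"
      using t(1,2) unfolding t(3)[symmetric] by (intro convex_sum convex_convex_hull hull_inc) auto
    have hull_join: "y \<in> join k X" if y: "y \<in> convex hull (x ` {..k})" for y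
    proof -
      obtain c where "\<And>i. 0 \<le> c i" "sum c {..k} = 1" "(\<Sum>i\<le>k. c i *\<^sub>R x i) = y"
        using convex_hull_image_weights[OF finite_atMost y] by blast
      then show ?thesis using x by (intro joinI[where t=c and x=x]) auto
    qed
    \<comment> \<open>\<open>p\<close> is nearest to 0 also within the hull of the
      \<open>x i\<close>, so no \<open>x i\<close> lies on the near side of the hyperplane through
      \<open>p\<close> orthogonal to \<open>p\<close>. As \<open>p\<close> is their average with
      positive weights, all lie on it.\<close>
    have px_ge: "p \<bullet> p \<le> p \<bullet> x i" if "i \<le> k" for i
    proof -
      have "(0 - p) \<bullet> (x i - p) \<le> 0"
        by (rule any_closest_point_dot[of "convex hull (x ` {..k})"])
           (use p_hull that near hull_join in \<open>auto intro: hull_inc compact_imp_closed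
              finite_imp_compact_convex_hull\<close>)
      then show ?thesis by (simp add: inner_diff_right)
    qed
    have "(\<Sum>i\<le>k. t i * (p \<bullet> x i - p \<bullet> p)) = p \<bullet> (\<Sum>i\<le>k. t i *\<^sub>R x i) - sum t {..k} * (p \<bullet> p)"
      by (simp add: inner_sum_right right_diff_distrib sum_subtractf sum_distrib_right)
    then have "(\<Sum>i\<le>k. t i * (p \<bullet> x i - p \<bullet> p)) = 0" using t by simp
    then have "\<forall>i\<in>{..k}. t i * (p \<bullet> x i - p \<bullet> p) = 0"
      by (subst (asm) sum_nonneg_eq_0_iff) (auto simp: t px_ge)
    then have px: "p \<bullet> x i = p \<bullet> p" if "i \<le> k" for i
      using tpos[OF that] that by force

    have card: "card (x ` {..k}) = Suc k"
      using aff_dim_le_card[of "x ` {..k}"] aff card_image_le[of "{..k}" x] by simp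
    then have inj: "inj_on x {..k}" by (intro eq_card_imp_inj_on) auto
    \<comment> \<open>That hyperplane misses 0, so a linear relation among the \<open>x i\<close>
      has coefficient sum 0 and would be an affine one.\<close>
    have ind: "independent (x ` {..k})"
    proof
      assume "dependent (x ` {..k})"
      then obtain u where u: "\<exists>v\<in>x ` {..k}. u v \<noteq> 0" "(\<Sum>v\<in>x ` {..k}. u v *\<^sub>R v) = 0"
        by (subst (asm) dependent_finite) auto
      have "0 = p \<bullet> (\<Sum>v\<in>x ` {..k}. u v *\<^sub>R v)" using u(2) by simp
      also have "\<dots> = (\<Sum>v\<in>x ` {..k}. u v * (p \<bullet> p))"
        unfolding inner_sum_right by (intro sum.cong) (auto simp: px)
      finally have "sum u (x ` {..k}) = 0"
        using p0 by (simp flip: sum_distrib_right)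
      then have "affine_dependent (x ` {..k})"
        using u by (auto simp: affine_dependent_explicit_finite)
      then show False using card aff affine_independent_iff_card[of "x ` {..k}"] by simp
    qed

    define D where "D = span ((\<lambda>v. - p + v) ` x ` {..k})"
    have p_aff: "p \<in> affine hull (x ` {..k})"
      using p_hull convex_hull_subset_affine_hull by blast
    have subD: "subspace D" by (simp add: D_def)
    have dimD: "dim D = k"
      using aff_dim_eq_dim[OF p_aff] aff by (simp add: D_def)
    have xD: "x i - p \<in> D" if "i \<le> k" for i
      unfolding D_def using that by (intro span_base) auto
    have D_aff: "v \<in> affine hull (x ` {..k})" if "v - p \<in> D" for v
      using that unfolding affine_hull_span_gen[OF p_aff] D_def
      by (intro image_eqI[of _ _ "v - p"]) auto

    \<comment> \<open>Any sequence tending to 1 from strictly below would serve; the strictness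
      yields the final contradiction.\<close>
    define s where "s n = real n / real (Suc n)" for n
    have s: "0 \<le> s n" "s n < 1" for n by (auto simp: s_def)
    \<comment> \<open>\<open>s n *\<^sub>R x i\<close> lies between 0 and \<open>x i\<close>, hence
      in the hull of \<open>X i\<close>, and it differs from \<open>s n *\<^sub>R p\<close> by a
      vector of \<open>D\<close>.\<close>
    have "\<exists>y\<in>X i. y - s n *\<^sub>R p \<in> D" if i: "i \<le> k" for i n
    proof -
      have "(1 - s n) *\<^sub>R 0 + s n *\<^sub>R x i \<in> convex hull (X i)"
        using s[of n] hull[OF i] hull_inc[OF x[OF i], of convex]
        by (intro convexD[OF convex_convex_hull]) auto
      then have "s n *\<^sub>R x i \<in> convex hull (X i)" by simp
      then obtain y where y: "y \<in> X i" "y - s n *\<^sub>R x i \<in> D"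
        using m_convex_meets[OF assms(3)[OF i] subD] dimD assms(1) by auto
      have "(y - s n *\<^sub>R x i) + s n *\<^sub>R (x i - p) \<in> D"
        using subD y(2) xD[OF i] by (intro subspace_add subspace_scale)
      then show ?thesis using y(1) by (auto simp: scaleR_diff_right)
    qed
    then obtain Y where Y: "\<And>i n. i \<le> k \<Longrightarrow> Y i n \<in> X i"
      "\<And>i n. i \<le> k \<Longrightarrow> Y i n - s n *\<^sub>R p \<in> D"
      by metis
    have "\<exists>z r. z \<in> X i \<and> strict_mono r \<and> (\<lambda>n. Y i (r n)) \<longlonglongrightarrow> z" if i: "i \<le> k" for i
    proof -
      have "\<forall>n. Y i n \<in> X i" using Y(1)[OF i] by blast
      then obtain z r where "z \<in> X i" "strict_mono r" "(Y i \<circ> r) \<longlonglongrightarrow> z"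
        using assms(2)[OF i] unfolding compact_def by blast
      then show ?thesis by (auto simp: o_def)
    qed
    \<comment> \<open>Each \<open>i\<close> has its own subsequence \<open>r i\<close>; the levels
      \<open>s (r i n)\<close> may therefore differ between indices.\<close>
    then obtain z r where z: "\<And>i. i \<le> k \<Longrightarrow> z i \<in> X i"
      and r: "\<And>i. i \<le> k \<Longrightarrow> strict_mono (r i :: nat \<Rightarrow> nat)"
      and Yz: "\<And>i. i \<le> k \<Longrightarrow> (\<lambda>n. Y i (r i n)) \<longlonglongrightarrow> z i"
      by metis
    have "s \<longlonglongrightarrow> 1"
      unfolding s_def by (rule LIMSEQ_n_over_Suc_n)
    then have sr: "(\<lambda>n. s (r i n)) \<longlonglongrightarrow> 1" if "i \<le> k" for i
      using LIMSEQ_subseq_LIMSEQ[OF _ r[OF that]] by (simp add: o_def)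
    have Yz': "(\<lambda>n. Y i (r i n) - s (r i n) *\<^sub>R p) \<longlonglongrightarrow> z i - p" if "i \<le> k" for i
      using tendsto_diff[OF Yz[OF that] tendsto_scaleR[OF sr[OF that] tendsto_const[of p]]] by simp
    have zD: "z i - p \<in> D" if "i \<le> k" for i
      using closed_sequentially[OF closed_subspace[OF subD] _ Yz'[OF that]] Y(2)[OF that] by blast

    obtain J c where J: "J \<subseteq> {..k}" "J \<noteq> {}" and c: "\<And>i. 0 \<le> c i" "sum c {..k} = 1"
      and facet: "(\<Sum>i\<le>k. c i *\<^sub>R (if i \<in> J then z i else x i)) = (\<Sum>i\<le>k. t i *\<^sub>R x i)"
      by (rule octahedron_second_facet[of "{..k}" x z t]) (use inj ind D_aff[OF zD] tpos t(2) in auto)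
    define v where "v i = (if i \<in> J then z i else x i)" for i
    have vp: "(\<Sum>i\<le>k. c i *\<^sub>R v i) = p"
      unfolding v_def using facet t(3) by simp
    have vX: "v i \<in> X i" if "i \<le> k" for i using x z that by (simp add: v_def)
    have cpos: "0 < c i" if "i \<le> k" for i
      using pos[of v c i] vX c vp that by blast
    have v_aff: "aff_dim (v ` {..k}) = int k"
      using dim_k[of v c] vX c vp by blast
    have "p \<in> convex hull (v ` {..k})"
      using c unfolding vp[symmetric] by (intro convex_sum convex_convex_hull hull_inc) auto
    then have "p \<in> affine hull (v ` {..k})"
      using convex_hull_subset_affine_hull by blast
    \<comment> \<open>The vertices of the second facet also represent \<open>p\<close>, so they too
      have affine dimension \<open>k\<close>, and the \<open>v i - p\<close> span all of
      \<open>D\<close>. This puts the perturbed vectors in the span required below.\<close>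
    then have "dim (span ((\<lambda>v. - p + v) ` v ` {..k})) = k"
      using aff_dim_eq_dim[of p "v ` {..k}"] v_aff by simp
    moreover have "span ((\<lambda>v. - p + v) ` v ` {..k}) \<subseteq> D"
      using zD xD by (intro span_minimal subD) (auto simp: v_def)
    ultimately have D_eq: "span ((\<lambda>i. v i - p) ` {..k}) = D"
      using subspace_dim_equal[OF subspace_span subD] dimD by (simp add: image_image)

    \<comment> \<open>\<open>V n i\<close> is a point of \<open>X i\<close> at level
      \<open>l n i\<close>, and \<open>w n i\<close> is its displacement along \<open>D\<close>.
      Indices outside \<open>J\<close> keep \<open>x i\<close> at level 1.\<close>
    define l where "l n i = (if i \<in> J then s (r i n) else 1)" for n i
    define V where "V n i = (if i \<in> J then Y i (r i n) else x i)" for n i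
    define w where "w n i = V n i - l n i *\<^sub>R p" for n i
    have wD: "w n i \<in> span ((\<lambda>i. v i - p) ` {..k})" if "i \<in> {..k}" for n i
      unfolding D_eq using that xD Y(2) by (auto simp: w_def V_def l_def)
    have w_lim: "(\<lambda>n. w n i) \<longlonglongrightarrow> v i - p" if "i \<in> {..k}" for i
      using Yz'[of i] that by (auto simp: w_def V_def l_def v_def)
    have "(\<Sum>i\<le>k. c i *\<^sub>R (v i - p)) = 0"
      using c(2) vp by (simp add: scaleR_diff_right sum_subtractf flip: scaleR_sum_left)
    then obtain n where "0 \<in> convex hull (w n ` {..k})"
      using zero_in_hull_perturbation[OF finite_atMost _ wD w_lim, of c] cpos by blast
    then obtain d where d: "\<And>i. 0 \<le> d i" "sum d {..k} = 1" "(\<Sum>i\<le>k. d i *\<^sub>R w n i) = 0"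
      using convex_hull_image_weights[of "{..k}" 0 "w n"] by auto
    \<comment> \<open>Once the displacements cancel, the combination of the \<open>V n i\<close> is
      \<open>p\<close> scaled by the average level \<open>L\<close>, which is at most 1. Minimality
      of \<open>p\<close> forces \<open>L\<close> to be 1, so every index of \<open>J\<close>,
      having level below 1, gets weight 0. Yet all weights representing \<open>p\<close> are
      positive.\<close>
    define L where "L = (\<Sum>i\<le>k. d i * l n i)"
    have VL: "(\<Sum>i\<le>k. d i *\<^sub>R V n i) = L *\<^sub>R p"
      using d(3) by (simp add: w_def L_def scaleR_diff_right sum_subtractf scaleR_sum_left)
    have VX: "V n i \<in> X i" if "i \<le> k" for i using x Y(1) that by (simp add: V_def)
    have l: "0 \<le> l n i" "l n i \<le> 1" for i using s[of "r i n"] by (auto simp: l_def)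
    have "L *\<^sub>R p \<in> join k X"
      using VX d VL by (intro joinI[where t=d and x="V n"]) auto
    then have "norm p \<le> \<bar>L\<bar> * norm p" using near by fastforce
    moreover have "0 \<le> L" unfolding L_def using d l by (intro sum_nonneg) auto
    ultimately have "1 \<le> L" using p0 by simp
    moreover have "(\<Sum>i\<le>k. d i * (1 - l n i)) = 1 - L"
      using d(2) by (simp add: L_def right_diff_distrib sum_subtractf)
    moreover have "0 \<le> (\<Sum>i\<le>k. d i * (1 - l n i))"
      using d l by (intro sum_nonneg) auto
    ultimately have L: "L = 1" "(\<Sum>i\<le>k. d i * (1 - l n i)) = 0" by auto
    obtain j where j: "j \<in> J" "j \<le> k" using J by auto
    have "d j * (1 - l n j) = 0"
      using L(2) j(2) d l by (subst (asm) sum_nonneg_eq_0_iff) auto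
    moreover have "l n j < 1" using j s by (simp add: l_def)
    ultimately have "d j = 0" by simp
    moreover have "0 < d j"
      using pos[of "V n" d j] VX d VL L(1) j(2) by simp
    ultimately show False by simp
  qed
  with p show ?thesis by simp
qed

end
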